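(* Let $\lambda_1,\lambda_2,\lambda_3\in\mathbb{R}$ satisfy $1\pm\lambda_3\ge|\lambda_1\pm\lambda_2|$, let $N\ge 1$ be an integer, and consider the Pauli channel with channel matrix $A=A(\lambda_1,\lambda_2,\lambda_3,0,0,0)=\mathrm{Diag}(\lambda_1,\lambda_2,\lambda_3)$. For measurement parameters $\underline{\tau}=(\tau_z,\tau_y,\tau_x)$ and input parameters $\underline{\vartheta}=(\vartheta_z,\vartheta_y,\vartheta_x)$, let $f(\underline{\lambda},\underline{0},\underline{\tau},\underline{\vartheta},N)$ be the mean squared error of the channel matrix estimate, $$f(\underline{\lambda},\underline{0},\underline{\tau},\underline{\vartheta},N)=\mathbf{E}\left(\|A(\hat\lambda_1,\hat\lambda_2,\hat\lambda_3,\hat\phi_z,\hat\phi_y,\hat\phi_x)-A(\lambda_1,\lambda_2,\lambda_3,0,0,0)\|^2\right),$$ where $\|\cdot\|$ is the Hilbert--Schmidt norm and the estimators are those described in the context. Then for all admissible $\underline{\tau},\underline{\vartheta}$ $$f(\underline{\lambda},\underline{0},\underline{\tau},\underline{\vartheta},N)\ge\frac1N\left(6-(\lambda_1^2+\lambda_2^2+\lambda_3^2)\right),$$ and equality holds if $\underline{\tau}=\underline{\vartheta}=\underline{0}$.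
   Context: Rotations: $R_z(\phi)=\begin{pmatrix}\cos\phi&-\sin\phi&0\\ \sin\phi&\cos\phi&0\\0&0&1\end{pmatrix}$, $R_y(\phi)=\begin{pmatrix}\cos\phi&0&-\sin\phi\\0&1&0\\ \sin\phi&0&\cos\phi\end{pmatrix}$, $R_x(\phi)=\begin{pmatrix}1&0&0\\0&\cos\phi&-\sin\phi\\0&\sin\phi&\cos\phi\end{pmatrix}$. Channel parametrization: $A(\lambda_1,\lambda_2,\lambda_3,\phi_z,\phi_y,\phi_x)=Q\,\mathrm{Diag}(\lambda_1,\lambda_2,\lambda_3)\,Q^{-1}$ with $Q=R_z(\phi_z)R_y(\phi_y)R_x(\phi_x)$. The condition $1\pm\lambda_3\ge|\lambda_1\pm\lambda_2|$ means $1+\lambda_3\ge|\lambda_1+\lambda_2|$ and $1-\lambda_3\ge|\lambda_1-\lambda_2|$; it implies $|\lambda_i|\le1$. Tomography settings: input matrix $\Theta=R_z(\vartheta_z)R_y(\vartheta_y)R_x(\vartheta_x)$ (columns are the input Bloch vectors) and measurement matrix $M=R_z(\tau_z)R_y(\tau_y)R_x(\tau_x)$ (columns are the measurement Bloch vectors), with $0\le\vartheta_z,\vartheta_y,\tau_z,\tau_y<\pi$ and $0\le\vartheta_x,\tau_x<\pi/2$. Put $X=(x_{ij})_{i,j=1}^3=M^TA\Theta$. The measured data are independent random variables $N_{ij}\sim\mathrm{Binom}\left(N,\frac{1+x_{ij}}2\right)$, $i,j\in\{1,2,3\}$. Estimators: $\hat x_{ij}=\frac2N N_{ij}-1$, $\hat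 X=(\hat x_{ij})$, $\hat A=M\hat X\Theta^T$, $\hat A_s=\frac12(\hat A+\hat A^T)$. The parameter estimates $(\hat\lambda_1,\hat\lambda_2,\hat\lambda_3,\hat\phi_z,\hat\phi_y,\hat\phi_x)$ are obtained from the orthonormal eigendecomposition of the symmetric matrix $\hat A_s$ (eigenvalues $\hat\lambda_1\ge\hat\lambda_2\ge\hat\lambda_3$, angles describing the eigenvectors), so that $A(\hat\lambda_1,\hat\lambda_2,\hat\lambda_3,\hat\phi_z,\hat\phi_y,\hat\phi_x)=\hat A_s$. *)

theory Defs
  imports "HOL-Probability.Probability"
begin

type_synonym angles = "real \<times> real \<times> real"
type_synonym eigvals = "real \<times> real \<times> real"

definition Rz :: "real \<Rightarrow> real^3^3" where
  "Rz p = vector [vector [cos p, - sin p, 0], vector [sin p, cos p, 0], vector [0, 0, 1]]"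

definition Ry :: "real \<Rightarrow> real^3^3" where
  "Ry p = vector [vector [cos p, 0, - sin p], vector [0, 1, 0], vector [sin p, 0, cos p]]"

definition Rx :: "real \<Rightarrow> real^3^3" where
  "Rx p = vector [vector [1, 0, 0], vector [0, cos p, - sin p], vector [0, sin p, cos p]]"

(* Angles are always listed in the order (z, y, x). *)
fun rot :: "angles \<Rightarrow> real^3^3" where
  "rot (pz, py, px) = Rz pz ** Ry py ** Rx px"

fun Diag :: "eigvals \<Rightarrow> real^3^3" where
  "Diag (l1, l2, l3) = vector [vector [l1, 0, 0], vector [0, l2, 0], vector [0, 0, l3]]"

definition channel :: "eigvals \<Rightarrow> angles \<Rightarrow> real^3^3" where
  "channel lam phi = rot phi ** Diag lam ** matrix_inv (rot phi)"

fun admissible_angles :: "angles \<Rightarrow> bool" where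
  "admissible_angles (pz, py, px) \<longleftrightarrow>
     0 \<le> pz \<and> pz < pi \<and> 0 \<le> py \<and> py < pi \<and> 0 \<le> px \<and> px < pi / 2"

fun admissible_eigvals :: "eigvals \<Rightarrow> bool" where
  "admissible_eigvals (l1, l2, l3) \<longleftrightarrow>
     1 + l3 \<ge> \<bar>l1 + l2\<bar> \<and> 1 - l3 \<ge> \<bar>l1 - l2\<bar>"

definition data_mean :: "eigvals \<Rightarrow> angles \<Rightarrow> angles \<Rightarrow> angles \<Rightarrow> real^3^3" where
  "data_mean lam phi tau theta = transpose (rot tau) ** channel lam phi ** rot theta"

(* D i j is the count N_ij and X the matrix (x_ij). *)
definition tomography_data ::
  "'w measure \<Rightarrow> (3 \<Rightarrow> 3 \<Rightarrow> 'w \<Rightarrow> nat) \<Rightarrow> real^3^3 \<Rightarrow> nat \<Rightarrow> bool" where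
  "tomography_data P D X N \<longleftrightarrow>
     prob_space P \<and>
     prob_space.indep_vars P (\<lambda>_. count_space UNIV) (\<lambda>(i, j). D i j) UNIV \<and>
     (\<forall>i j. distr P (count_space UNIV) (D i j)
            = measure_pmf (binomial_pmf N ((1 + X $ i $ j) / 2)))"

definition X_hat :: "nat \<Rightarrow> (3 \<Rightarrow> 3 \<Rightarrow> nat) \<Rightarrow> real^3^3" where
  "X_hat N d = (\<chi> i j. 2 / real N * real (d i j) - 1)"

definition A_hat :: "angles \<Rightarrow> angles \<Rightarrow> nat \<Rightarrow> (3 \<Rightarrow> 3 \<Rightarrow> nat) \<Rightarrow> real^3^3" where
  "A_hat tau theta N d = rot tau ** X_hat N d ** transpose (rot theta)"

definition A_hat_s :: "angles \<Rightarrow> angles \<Rightarrow> nat \<Rightarrow> (3 \<Rightarrow> 3 \<Rightarrow> nat) \<Rightarrow> real^3^3" where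
  "A_hat_s tau theta N d = (1/2) *\<^sub>R (A_hat tau theta N d + transpose (A_hat tau theta N d))"

fun ordered_eigvals :: "eigvals \<Rightarrow> bool" where
  "ordered_eigvals (l1, l2, l3) \<longleftrightarrow> l1 \<ge> l2 \<and> l2 \<ge> l3"

(* The angles of an orthonormal eigenbasis are never unique, so an eigendecomposition is
   an arbitrary rule choosing eigenvalues and angles for each symmetric matrix;
   eigen_rule_exists below shows that there is such a rule. Since rot phi is orthogonal,
   its columns are orthonormal eigenvectors of S, in the order of the eigenvalues. *)
definition eigen_rule :: "(real^3^3 \<Rightarrow> eigvals \<times> angles) \<Rightarrow> bool" where
  "eigen_rule est \<longleftrightarrow>
     (\<forall>S. transpose S = S \<longrightarrow>
        ordered_eigvals (fst (est S)) \<and> channel (fst (est S)) (snd (est S)) = S)"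

(* The library norm on real^3^3 is the Hilbert-Schmidt norm, see norm_eq_hilbert_schmidt. *)
definition channel_mse ::
  "(real^3^3 \<Rightarrow> eigvals \<times> angles) \<Rightarrow> 'w measure \<Rightarrow> (3 \<Rightarrow> 3 \<Rightarrow> 'w \<Rightarrow> nat) \<Rightarrow>
   eigvals \<Rightarrow> angles \<Rightarrow> angles \<Rightarrow> angles \<Rightarrow> nat \<Rightarrow> real" where
  "channel_mse est P D lam phi tau theta N =
     prob_space.expectation P (\<lambda>w.
       let (lam_hat, phi_hat) = est (A_hat_s tau theta N (\<lambda>i j. D i j w))
       in (norm (channel lam_hat phi_hat - channel lam phi))\<^sup>2)"

lemma norm_eq_hilbert_schmidt:
  fixes A :: "real^3^3"
  shows "norm A = sqrt (trace (transpose A ** A))"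
proof -
  have "(\<Sum>i\<in>UNIV. \<Sum>j\<in>UNIV. (A $ i $ j)\<^sup>2) = trace (transpose A ** A)"
    unfolding trace_def matrix_matrix_mult_def transpose_def
    by (subst sum.swap) (simp add: power2_eq_square)
  then show ?thesis
    by (simp add: norm_vec_def L2_set_def sum_nonneg)
qed

lemma matrix3_eq_iff:
  fixes A B :: "real^3^3"
  shows "A = B \<longleftrightarrow>
    A$1$1 = B$1$1 \<and> A$1$2 = B$1$2 \<and> A$1$3 = B$1$3 \<and>
    A$2$1 = B$2$1 \<and> A$2$2 = B$2$2 \<and> A$2$3 = B$2$3 \<and>
    A$3$1 = B$3$1 \<and> A$3$2 = B$3$2 \<and> A$3$3 = B$3$3"
  by (auto simp: vec_eq_iff forall_3)

lemmas matrix3_simps =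
  matrix_matrix_mult_def transpose_def sum_3 mat_def Rz_def Ry_def Rx_def

lemma rotation_group_mult:
  fixes P Q :: "real^3^3"
  assumes "transpose P ** P = mat 1" "det P = 1" "transpose Q ** Q = mat 1" "det Q = 1"
  shows "transpose (P ** Q) ** (P ** Q) = mat 1" "det (P ** Q) = 1"
proof -
  have "transpose (P ** Q) ** (P ** Q) = transpose Q ** (transpose P ** P) ** Q"
    by (simp add: matrix_transpose_mul matrix_mul_assoc)
  then show "transpose (P ** Q) ** (P ** Q) = mat 1"
    using assms by simp
  show "det (P ** Q) = 1"
    using assms by (simp add: det_mul)
qed

lemma orthogonal_Rz: "transpose (Rz p) ** Rz p = mat 1" "det (Rz p) = 1"
  using sin_cos_squared_add[of p]
  by (auto simp: matrix3_eq_iff matrix3_simps det_3 algebra_simps power2_eq_square)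

lemma orthogonal_Ry: "transpose (Ry p) ** Ry p = mat 1" "det (Ry p) = 1"
  using sin_cos_squared_add[of p]
  by (auto simp: matrix3_eq_iff matrix3_simps det_3 algebra_simps power2_eq_square)

lemma orthogonal_Rx: "transpose (Rx p) ** Rx p = mat 1" "det (Rx p) = 1"
  using sin_cos_squared_add[of p]
  by (auto simp: matrix3_eq_iff matrix3_simps det_3 algebra_simps power2_eq_square)

lemma orthogonal_rot: "transpose (rot p) ** rot p = mat 1" "det (rot p) = 1"
  by (cases p; simp only: rot.simps;
      intro rotation_group_mult orthogonal_Rz orthogonal_Ry orthogonal_Rx)+

lemma matrix_inv_rot: "matrix_inv (rot p) = transpose (rot p)"
proof -
  have "rot p ** transpose (rot p) = mat 1"
    using orthogonal_rot(1) matrix_left_right_inverse by blast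
  then have "\<exists>A'. rot p ** A' = mat 1 \<and> A' ** rot p = mat 1"
    using orthogonal_rot(1)[of p] by (intro exI[of _ "transpose (rot p)"] conjI)
  from someI_ex[OF this] have "rot p ** matrix_inv (rot p) = mat 1"
    unfolding matrix_inv_def by (rule conjunct1)
  then have "transpose (rot p) ** (rot p ** matrix_inv (rot p)) = transpose (rot p)"
    by simp
  then show ?thesis
    by (simp only: matrix_mul_assoc orthogonal_rot(1) matrix_mul_lid)
qed

lemma euler_angles_exist:
  fixes Q :: "real^3^3"
  assumes "transpose Q ** Q = mat 1" "det Q = 1"
  shows "\<exists>p. rot p = Q"
proof -
  define r where "r = sqrt ((Q$1$1)\<^sup>2 + (Q$2$1)\<^sup>2)"
  have unit: "(Q$1$1)\<^sup>2 + (Q$2$1)\<^sup>2 + (Q$3$1)\<^sup>2 = 1"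
    using assms(1) by (auto simp: matrix3_eq_iff matrix3_simps power2_eq_square)
  have "r\<^sup>2 + (Q$3$1)\<^sup>2 = 1"
    using unit by (simp add: r_def)
  then obtain y where y: "r = cos y" "Q$3$1 = sin y"
    by (metis sincos_total_2pi)
  obtain z where z: "Q$1$1 = r * cos z" "Q$2$1 = r * sin z"
  proof -
    define w where "w = Complex (Q$1$1) (Q$2$1)"
    have "cmod w = r"
      by (simp add: w_def r_def cmod_def)
    then have "Re w = r * cos (Arg w)" "Im w = r * sin (Arg w)"
      by (metis rcis_cmod_Arg Re_rcis, metis rcis_cmod_Arg Im_rcis)
    then show ?thesis
      using that by (simp add: w_def)
  qed
  define U where "U = Rz z ** Ry y"
  define W where "W = transpose U ** Q"
  have U: "transpose U ** U = mat 1" "det U = 1"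
    unfolding U_def by (intro rotation_group_mult orthogonal_Rz orthogonal_Ry)+
  then have U': "U ** transpose U = mat 1"
    using matrix_left_right_inverse by blast
  have "transpose (transpose U) ** transpose U = mat 1" "det (transpose U) = 1"
    using U U' by simp_all
  then have W: "transpose W ** W = mat 1" "det W = 1"
    unfolding W_def using assms rotation_group_mult by blast+
  have W': "W ** transpose W = mat 1"
    using W(1) matrix_left_right_inverse by blast
  have col: "U$1$1 = Q$1$1" "U$2$1 = Q$2$1" "U$3$1 = Q$3$1"
    using y z by (simp_all add: U_def matrix3_simps)
  have W11: "W$1$1 = 1" and W21: "W$2$1 = 0" and W31: "W$3$1 = 0"
    using U(1) by (simp_all add: W_def matrix3_eq_iff matrix3_simps flip: col)
  have "(W$1$1)\<^sup>2 + (W$1$2)\<^sup>2 + (W$1$3)\<^sup>2 = 1"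
    using W' by (auto simp: matrix3_eq_iff matrix3_simps power2_eq_square)
  then have W12: "W$1$2 = 0" and W13: "W$1$3 = 0"
    using W11 by (auto simp: sum_power2_eq_zero_iff)
  have c2: "(W$2$2)\<^sup>2 + (W$3$2)\<^sup>2 = 1" and c3: "(W$2$3)\<^sup>2 + (W$3$3)\<^sup>2 = 1"
    using W(1) W12 W13 by (auto simp: matrix3_eq_iff matrix3_simps power2_eq_square)
  have d: "W$2$2 * W$3$3 - W$2$3 * W$3$2 = 1"
    using W(2) W11 W12 W13 W21 W31 by (simp add: det_3)
  have "(W$3$3 - W$2$2)\<^sup>2 + (W$2$3 + W$3$2)\<^sup>2 = 0"
    using c2 c3 d by (simp add: power2_eq_square algebra_simps)
  then have e: "W$3$3 = W$2$2" "W$2$3 = - W$3$2"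
    by (auto simp: sum_power2_eq_zero_iff)
  obtain x where x: "W$2$2 = cos x" "W$3$2 = sin x"
    using c2 by (metis sincos_total_2pi)
  have "Rx x = W"
    using x e W11 W12 W13 W21 W31 by (simp add: matrix3_eq_iff matrix3_simps)
  moreover have "U ** W = Q"
    using U' by (simp add: W_def matrix_mul_assoc)
  ultimately have "rot (z, y, x) = Q"
    by (simp add: U_def)
  then show ?thesis ..
qed

lemma trig_max:
  fixes a b c :: real
  assumes "\<And>t. a * (cos t)\<^sup>2 + 2 * b * (cos t * sin t) + c * (sin t)\<^sup>2 \<le> a"
  shows "b = 0" "c \<le> a"
proof -
  show "c \<le> a"
    using assms[of "pi/2"] by simp
  show "b = 0"
  proof (rule ccontr)
    assume "b \<noteq> 0"
    define h where "h = (a - c) / 2"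
    define s where "s = sqrt (h\<^sup>2 + b\<^sup>2)"
    have "s > 0"
      using \<open>b \<noteq> 0\<close> by (simp add: s_def add_nonneg_pos)
    have ss: "s\<^sup>2 = h\<^sup>2 + b\<^sup>2"
      by (simp add: s_def)
    have "(h / s)\<^sup>2 + (b / s)\<^sup>2 = 1"
      using \<open>s > 0\<close> by (simp add: power_divide flip: add_divide_distrib ss)
    then obtain u where u: "h / s = cos u" "b / s = sin u"
      by (metis sincos_total_2pi)
    then have u': "h = s * cos u" "b = s * sin u"
      using \<open>s > 0\<close> by (auto simp: field_simps)
    define t where "t = u / 2"
    have t2: "(cos t)\<^sup>2 = (1 + cos u) / 2" "(sin t)\<^sup>2 = (1 - cos u) / 2" "2 * (cos t * sin t) = sin u"
      using cos_double_cos[of t] cos_double_sin[of t] sin_double[of t] by (simp_all add: t_def)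
    have "a * (cos t)\<^sup>2 + b * (2 * (cos t * sin t)) + c * (sin t)\<^sup>2 \<le> a"
      using assms[of t] by (simp only: mult.assoc mult.left_commute)
    then have "a * ((1 + cos u) / 2) + b * sin u + c * ((1 - cos u) / 2) \<le> a"
      by (simp only: t2)
    moreover have "h * cos u + b * sin u - h = a * ((1 + cos u) / 2) + b * sin u + c * ((1 - cos u) / 2) - a"
      by (simp add: h_def field_simps)
    ultimately have "h * cos u + b * sin u \<le> h"
      by linarith
    moreover have "h * cos u + b * sin u = s * ((cos u)\<^sup>2 + (sin u)\<^sup>2)"
      by (simp only: u' power2_eq_square distrib_left mult.assoc)
    ultimately have "s \<le> h"
      by simp
    then have "s\<^sup>2 \<le> h\<^sup>2"
      using \<open>s > 0\<close> by (intro power_mono) auto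
    then show False
      using ss \<open>b \<noteq> 0\<close> by simp
  qed
qed

lemma conjugate_entries:
  fixes C R :: "real^3^3"
  shows "(transpose R ** C ** R) $ i $ i =
    C$1$1 * (R$1$i)\<^sup>2 + C$2$2 * (R$2$i)\<^sup>2 + C$3$3 * (R$3$i)\<^sup>2 +
    (C$1$2 + C$2$1) * (R$1$i * R$2$i) + (C$1$3 + C$3$1) * (R$1$i * R$3$i) +
    (C$2$3 + C$3$2) * (R$2$i * R$3$i)"
  by (simp add: matrix_matrix_mult_def transpose_def sum_3 power2_eq_square algebra_simps)

(* Maximise 3 B11 + 2 B22 + B33 over B = Q^T S Q with Q a rotation: at the maximum, B is
   diagonal with decreasing entries. *)
lemma eigendecomposition_exists:
  fixes S :: "real^3^3"
  assumes S: "transpose S = S"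
  shows "\<exists>lam phi. ordered_eigvals lam \<and> channel lam phi = S"
proof -
  define K where "K = {Q :: real^3^3. transpose Q ** Q = mat 1 \<and> det Q = 1}"
  define B where "B = (\<lambda>Q :: real^3^3. transpose Q ** S ** Q)"
  define g where "g = (\<lambda>Q. 3 * B Q $1$1 + 2 * B Q $2$2 + B Q $3$3)"
  have "bounded K"
  proof (rule boundedI)
    fix Q assume "Q \<in> K"
    then have "trace (transpose Q ** Q) = 3"
      by (simp add: K_def trace_I)
    then show "norm Q \<le> sqrt 3"
      by (simp add: norm_eq_hilbert_schmidt)
  qed
  moreover have "closed K"
    unfolding K_def det_3 matrix3_eq_iff matrix_matrix_mult_def transpose_def sum_3
    by (auto intro!: closed_Collect_conj closed_Collect_eq continuous_intros)
  ultimately have "compact K"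
    by (simp add: compact_eq_bounded_closed)
  moreover have "mat 1 \<in> K"
    by (simp add: K_def)
  moreover have "continuous_on K g"
    unfolding g_def B_def conjugate_entries by (intro continuous_intros)
  ultimately obtain Q where Q: "Q \<in> K" and Qmax: "\<And>Q'. Q' \<in> K \<Longrightarrow> g Q' \<le> g Q"
    by (metis continuous_attains_sup empty_iff)
  have symB: "transpose (B Q) = B Q"
    by (simp add: B_def matrix_transpose_mul S matrix_mul_assoc)
  have "B Q $ j $ i = B Q $ i $ j" for i j
    using arg_cong[OF symB, of "\<lambda>M. M $ i $ j"] by (simp add: transpose_def)
  then have sym: "B Q $2$1 = B Q $1$2" "B Q $3$1 = B Q $1$3" "B Q $3$2 = B Q $2$3"
    by blast+
  have BR: "B (Q ** R) = transpose R ** B Q ** R" for R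
    by (simp add: B_def matrix_transpose_mul matrix_mul_assoc)
  have le: "g (Q ** R) \<le> g Q" if "transpose R ** R = mat 1" "det R = 1" for R
    using Q that rotation_group_mult[of Q R] by (intro Qmax) (auto simp: K_def)
  have 1: "B Q $1$2 = 0" "B Q $2$2 \<le> B Q $1$1"
  proof -
    have "B Q$1$1 * (cos t)\<^sup>2 + 2 * B Q$1$2 * (cos t * sin t) + B Q$2$2 * (sin t)\<^sup>2 \<le> B Q$1$1" for t
    proof -
      have "g (Q ** Rz t) - g Q = (B Q$1$1 * (cos t)\<^sup>2 + 2 * B Q$1$2 * (cos t * sin t) + B Q$2$2 * (sin t)\<^sup>2) - B Q$1$1"
        unfolding g_def BR
        by (simp add: conjugate_entries Rz_def Ry_def Rx_def sym sin_squared_eq algebra_simps)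
      then show ?thesis
        using le[OF orthogonal_Rz[of t]] by simp
    qed
    from trig_max[OF this] show "B Q $1$2 = 0" "B Q $2$2 \<le> B Q $1$1"
      by auto
  qed
  have 2: "B Q $2$3 = 0" "B Q $3$3 \<le> B Q $2$2"
  proof -
    have "B Q$2$2 * (cos t)\<^sup>2 + 2 * B Q$2$3 * (cos t * sin t) + B Q$3$3 * (sin t)\<^sup>2 \<le> B Q$2$2" for t
    proof -
      have "g (Q ** Rx t) - g Q = (B Q$2$2 * (cos t)\<^sup>2 + 2 * B Q$2$3 * (cos t * sin t) + B Q$3$3 * (sin t)\<^sup>2) - B Q$2$2"
        unfolding g_def BR
        by (simp add: conjugate_entries Rz_def Ry_def Rx_def sym sin_squared_eq algebra_simps)
      then show ?thesis
        using le[OF orthogonal_Rx[of t]] by simp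
    qed
    from trig_max[OF this] show "B Q $2$3 = 0" "B Q $3$3 \<le> B Q $2$2"
      by auto
  qed
  have 3: "B Q $1$3 = 0"
  proof -
    have "B Q$1$1 * (cos t)\<^sup>2 + 2 * B Q$1$3 * (cos t * sin t) + B Q$3$3 * (sin t)\<^sup>2 \<le> B Q$1$1" for t
    proof -
      have "g (Q ** Ry t) - g Q = 2 * ((B Q$1$1 * (cos t)\<^sup>2 + 2 * B Q$1$3 * (cos t * sin t) + B Q$3$3 * (sin t)\<^sup>2) - B Q$1$1)"
        unfolding g_def BR
        by (simp add: conjugate_entries Rz_def Ry_def Rx_def sym sin_squared_eq algebra_simps)
      then show ?thesis
        using le[OF orthogonal_Ry[of t]] by simp
    qed
    from trig_max(1)[OF this] show ?thesis .
  qed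
  define lam where "lam = (B Q $1$1, B Q $2$2, B Q $3$3)"
  have D: "Diag lam = B Q"
    using 1 2 3 sym by (simp add: lam_def matrix3_eq_iff)
  obtain phi where phi: "rot phi = Q"
    using euler_angles_exist Q unfolding K_def by blast
  have QQ: "Q ** transpose Q = mat 1"
    using Q matrix_left_right_inverse unfolding K_def by blast
  have "Q ** B Q ** transpose Q = (Q ** transpose Q) ** S ** (Q ** transpose Q)"
    by (simp only: B_def matrix_mul_assoc)
  then have "Q ** B Q ** transpose Q = S"
    by (simp add: QQ)
  then have "channel lam phi = S"
    using matrix_inv_rot[of phi] by (simp add: channel_def phi D)
  moreover have "ordered_eigvals lam"
    using 1 2 by (simp add: lam_def)
  ultimately show ?thesis
    by blast
qed

lemma eigen_rule_exists: "\<exists>est. eigen_rule est"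
proof -
  have "\<forall>S. \<exists>e. transpose S = S \<longrightarrow> ordered_eigvals (fst e) \<and> channel (fst e) (snd e) = S"
    using eigendecomposition_exists by (metis fst_conv snd_conv)
  then show ?thesis
    unfolding eigen_rule_def by (rule choice)
qed

end

theory Submission
  imports Defs
begin

text \<open>
  Write $M$, $\Theta$ for the two rotations and $m_i$, $\theta_j$ for their columns. The
  estimation error of the symmetrised matrix is $\sum_{ij} e_{ij} C_{ij}$, where $C_{ij}$ is the
  symmetric part of $m_i \theta_j^T$ and the $e_{ij} = \hat x_{ij} - x_{ij}$ are independent and
  centred with variance $(1 - x_{ij}^2)/N$. As $\|C_{ij}\|^2 = (1 + s_{ij}^2)/2$ with
  $s_{ij} = m_i \cdot \theta_j$, and $\sum s_{ij}^2 = 3$, $\sum x_{ij}^2 = \sum \lambda_k^2$,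
  the mean squared error is $(12 - \sum \lambda_k^2 - \sum s_{ij}^2 x_{ij}^2)/(2N)$. Since
  $|s_{ij}| \le 1$, the last sum is at most $\sum x_{ij}^2 = \sum \lambda_k^2$, with equality
  if $M = \Theta = I$.
\<close>

section \<open>Moments of the binomial distribution\<close>

lemma binomial_pmf_first_moment:
  assumes "p \<in> {0..1}"
  shows "measure_pmf.expectation (binomial_pmf n p) real = real n * p"
  using sum_k_Bernstein[of n p]
  by (simp add: expectation_binomial_pmf'[OF assms] Bernstein_def mult_ac)

text \<open>Rewriting the square through \<open>k * (k - 1)\<close> and \<open>k\<close> reduces it
  to the two moment identities for Bernstein polynomials.\<close>

lemma binomial_pmf_centered_second_moment:
  assumes "p \<in> {0..1}"
  shows "measure_pmf.expectation (binomial_pmf n p) (\<lambda>k. (real k - real n * p)\<^sup>2)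
           = real n * p * (1 - p)"
proof -
  have "measure_pmf.expectation (binomial_pmf n p) (\<lambda>k. (real k - real n * p)\<^sup>2)
      = measure_pmf.expectation (binomial_pmf n p)
          (\<lambda>k. real k * (real k - 1) + (1 - 2 * real n * p) * real k + (real n * p)\<^sup>2)"
    by (simp add: power2_eq_square algebra_simps)
  also have "\<dots> = measure_pmf.expectation (binomial_pmf n p) (\<lambda>k. real k * (real k - 1))
      + (1 - 2 * real n * p) * measure_pmf.expectation (binomial_pmf n p) real + (real n * p)\<^sup>2"
    using assms by (simp add: integrable_binomial_pmf)
  also have "measure_pmf.expectation (binomial_pmf n p) (\<lambda>k. real k * (real k - 1))
      = real n * (real n - 1) * p\<^sup>2"
    using sum_kk_Bernstein[of n p]
    by (simp add: expectation_binomial_pmf'[OF assms] Bernstein_def mult_ac)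
  finally show ?thesis
    by (simp add: binomial_pmf_first_moment[OF assms] power2_eq_square algebra_simps)
qed

text \<open>Independence factors each mixed moment of \<open>e i\<close> and \<open>e j\<close> into
  a product of means, which vanishes. Hence only the diagonal inner products survive, whatever the
  angles between the vectors \<open>C i\<close>.\<close>

lemma (in prob_space) expectation_norm_sum_sq_indep:
  fixes e :: "'i \<Rightarrow> 'a \<Rightarrow> real" and C :: "'i \<Rightarrow> 'b::real_inner"
  assumes I: "finite I"
    and indep: "indep_vars (\<lambda>_. borel) e I"
    and int: "\<And>i. i \<in> I \<Longrightarrow> integrable M (e i)"
    and int2: "\<And>i. i \<in> I \<Longrightarrow> integrable M (\<lambda>w. (e i w)\<^sup>2)"
    and centered: "\<And>i. i \<in> I \<Longrightarrow> expectation (e i) = 0"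
  shows "expectation (\<lambda>w. (norm (\<Sum>i\<in>I. e i w *\<^sub>R C i))\<^sup>2)
           = (\<Sum>i\<in>I. expectation (\<lambda>w. (e i w)\<^sup>2) * (norm (C i))\<^sup>2)"
proof -
  have pair: "integrable M (\<lambda>w. e i w * e j w)"
    "expectation (\<lambda>w. e i w * e j w) = (if i = j then expectation (\<lambda>w. (e i w)\<^sup>2) else 0)"
    if ij: "i \<in> I" "j \<in> I" for i j
  proof -
    have "integrable M (\<lambda>w. e i w * e j w) \<and>
      expectation (\<lambda>w. e i w * e j w) = (if i = j then expectation (\<lambda>w. (e i w)\<^sup>2) else 0)"
    proof (cases "i = j")
      case True
      with int2 ij show ?thesis by (simp add: power2_eq_square)
    next
      case False
      have sub: "indep_vars (\<lambda>_. borel) e {i, j}"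
        using indep ij by (intro indep_vars_subset[OF indep]) auto
      show ?thesis
        using indep_vars_integrable[OF _ sub] indep_vars_lebesgue_integral[OF _ sub]
          int centered ij False by auto
    qed
    then show "integrable M (\<lambda>w. e i w * e j w)"
      "expectation (\<lambda>w. e i w * e j w) = (if i = j then expectation (\<lambda>w. (e i w)\<^sup>2) else 0)"
      by blast+
  qed
  have "expectation (\<lambda>w. (norm (\<Sum>i\<in>I. e i w *\<^sub>R C i))\<^sup>2)
      = expectation (\<lambda>w. \<Sum>i\<in>I. \<Sum>j\<in>I. (e i w * e j w) * (C i \<bullet> C j))"
    by (simp add: power2_norm_eq_inner inner_sum_left inner_sum_right sum_distrib_left
        inner_commute mult_ac)
  also have "\<dots> = (\<Sum>i\<in>I. \<Sum>j\<in>I. expectation (\<lambda>w. e i w * e j w) * (C i \<bullet> C j))"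
    by (simp add: pair(1) Bochner_Integration.integral_sum)
  also have "\<dots> = (\<Sum>i\<in>I. \<Sum>j\<in>I. if i = j then expectation (\<lambda>w. (e i w)\<^sup>2) * (C i \<bullet> C j) else 0)"
    by (intro sum.cong refl) (simp add: pair(2))
  also have "\<dots> = (\<Sum>i\<in>I. expectation (\<lambda>w. (e i w)\<^sup>2) * (norm (C i))\<^sup>2)"
    by (simp add: I power2_norm_eq_inner)
  finally show ?thesis .
qed

section \<open>Columns of rotations and the Hilbert-Schmidt norm\<close>

lemma norm_matrix_sq:
  fixes A :: "real^'n^'m"
  shows "(norm A)\<^sup>2 = (\<Sum>i\<in>UNIV. \<Sum>j\<in>UNIV. (A $ i $ j)\<^sup>2)"
  by (simp add: norm_vec_def L2_set_def sum_nonneg)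

lemma matrix_add_rdistrib:
  fixes B C :: "'a::semiring_1^'n^'m" and A :: "'a^'p^'n"
  shows "(B + C) ** A = B ** A + C ** A"
  by (simp add: vec_eq_iff matrix_matrix_mult_def sum.distrib distrib_right)

lemma orthogonal_rot': "rot p ** transpose (rot p) = mat 1"
  using orthogonal_rot(1) matrix_left_right_inverse by blast

lemma rot_col_inner: "(\<Sum>a\<in>UNIV. rot p $ a $ i * rot p $ a $ j) = (if i = j then 1 else 0)"
  using arg_cong[OF orthogonal_rot(1)[of p], of "\<lambda>B. B $ i $ j"]
  by (simp add: matrix_matrix_mult_def transpose_def mat_def)

lemma rot_col_norm: "(\<Sum>a\<in>UNIV. (rot p $ a $ i)\<^sup>2) = 1"
  using rot_col_inner[of p i i] by (simp add: power2_eq_square)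

text \<open>Cyclicity of the trace brings \<open>rot q\<close> next to its transpose, where the two
  cancel. This evaluates the sums of squares of both the data means and the column inner
  products.\<close>

lemma norm_rot_conjugate:
  "norm (transpose (rot p) ** B ** rot q) = norm (B :: real^3^3)"
proof -
  define X where "X = transpose (rot p) ** B ** rot q"
  have "transpose X ** X
      = transpose (rot q) ** (transpose B ** (rot p ** transpose (rot p)) ** B ** rot q)"
    by (simp add: X_def matrix_transpose_mul matrix_mul_assoc)
  then have "trace (transpose X ** X) = trace (transpose B ** B ** rot q ** transpose (rot q))"
    by (simp add: orthogonal_rot' trace_mul_sym[of "transpose (rot q)"])
  then have "trace (transpose X ** X) = trace (transpose B ** B)"
    by (simp add: orthogonal_rot' flip: matrix_mul_assoc)
  then show ?thesis
    by (simp add: norm_eq_hilbert_schmidt X_def)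
qed

text \<open>The symmetric part of the outer product of column \<open>i\<close> of \<open>M\<close>
  and column \<open>j\<close> of \<open>T\<close>.\<close>

definition sym_dyad :: "real^3^3 \<Rightarrow> real^3^3 \<Rightarrow> 3 \<Rightarrow> 3 \<Rightarrow> real^3^3" where
  "sym_dyad M T i j = (\<chi> a b. (M $ a $ i * T $ b $ j + M $ b $ i * T $ a $ j) / 2)"

text \<open>For unit columns m and t, the four terms of the expanded square give two products of
  squared norms and two squares of the inner product of m and t, which is entry (i, j) of
  \<open>transpose M ** T\<close>.\<close>

lemma norm_sym_dyad_sq:
  assumes "(\<Sum>a\<in>UNIV. (M $ a $ i)\<^sup>2) = 1" "(\<Sum>a\<in>UNIV. (T $ a $ j)\<^sup>2) = 1"
  shows "(norm (sym_dyad M T i j))\<^sup>2 = (1 + ((transpose M ** T) $ i $ j)\<^sup>2) / 2"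
proof -
  define m where "m = (\<lambda>a. M $ a $ i)"
  define t where "t = (\<lambda>a. T $ a $ j)"
  have m: "(\<Sum>a\<in>UNIV. (m a)\<^sup>2) = 1" and t: "(\<Sum>a\<in>UNIV. (t a)\<^sup>2) = 1"
    using assms by (simp_all add: m_def t_def)
  have "(norm (sym_dyad M T i j))\<^sup>2
      = (\<Sum>a\<in>UNIV. \<Sum>b\<in>UNIV. ((m a * t b + m b * t a) / 2)\<^sup>2)"
    by (simp add: norm_matrix_sq sym_dyad_def m_def t_def)
  also have "\<dots> = (2 * ((\<Sum>a\<in>UNIV. (m a)\<^sup>2) * (\<Sum>a\<in>UNIV. (t a)\<^sup>2))
      + 2 * (\<Sum>a\<in>UNIV. m a * t a)\<^sup>2) / 4"
    by (simp add: sum_3 power2_eq_square field_simps)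
  finally show ?thesis
    by (simp add: m t) (simp add: m_def t_def matrix_matrix_mult_def transpose_def)
qed

text \<open>\<open>M ** E ** transpose T\<close> is the combination of the column dyads with
  coefficients \<open>E $ i $ j\<close>, and taking the symmetric part is linear.\<close>

lemma sym_part_eq_sum_sym_dyad:
  fixes M E T :: "real^3^3"
  shows "(1/2) *\<^sub>R (M ** E ** transpose T + transpose (M ** E ** transpose T))
    = (\<Sum>(i, j)\<in>UNIV. E $ i $ j *\<^sub>R sym_dyad M T i j)"
  by (simp add: vec_eq_iff sym_dyad_def matrix_matrix_mult_def transpose_def sum_3
      UNIV_Times_UNIV[symmetric] sum.cartesian_product[symmetric] field_simps
      del: UNIV_Times_UNIV)

section \<open>Range of the data means\<close>

lemma admissible_eigvals_bound:
  assumes "admissible_eigvals (l1, l2, l3)"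
  shows "\<bar>l1\<bar> \<le> 1" "\<bar>l2\<bar> \<le> 1" "\<bar>l3\<bar> \<le> 1"
  \<comment> \<open>The sum of the two conditions bounds twice the larger of
    \<open>\<bar>l1\<bar>\<close>, \<open>\<bar>l2\<bar>\<close> by 2; each alone bounds
    \<open>l3\<close> from one side.\<close>
  using assms by auto

lemma channel_zero: "channel lam (0, 0, 0) = Diag lam"
proof -
  have "rot (0, 0, 0) = mat 1"
    by (simp add: matrix3_eq_iff matrix3_simps)
  then show ?thesis
    unfolding channel_def matrix_inv_rot by (simp add: transpose_mat)
qed

text \<open>Dropping the factor \<open>l a\<close> and applying the arithmetic-geometric mean
  inequality termwise leaves the average of two unit norms.\<close>

lemma unit_diag_bilinear_bound:
  fixes m t l :: "3 \<Rightarrow> real"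
  assumes m: "(\<Sum>a\<in>UNIV. (m a)\<^sup>2) = 1" and t: "(\<Sum>a\<in>UNIV. (t a)\<^sup>2) = 1"
    and l: "\<And>a. \<bar>l a\<bar> \<le> 1"
  shows "\<bar>\<Sum>a\<in>UNIV. m a * l a * t a\<bar> \<le> 1"
proof -
  have "\<bar>m a * l a * t a\<bar> \<le> ((m a)\<^sup>2 + (t a)\<^sup>2) / 2" for a
  proof -
    have "\<bar>m a * l a * t a\<bar> = \<bar>l a\<bar> * (\<bar>m a\<bar> * \<bar>t a\<bar>)"
      by (simp add: abs_mult)
    also have "\<dots> \<le> \<bar>m a\<bar> * \<bar>t a\<bar>"
      using l[of a] by (simp add: mult_left_le_one_le)
    also have "\<dots> \<le> ((m a)\<^sup>2 + (t a)\<^sup>2) / 2"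
      using sum_squares_bound[of "\<bar>m a\<bar>" "\<bar>t a\<bar>"] by simp
    finally show ?thesis .
  qed
  then have "\<bar>\<Sum>a\<in>UNIV. m a * l a * t a\<bar> \<le> (\<Sum>a\<in>UNIV. ((m a)\<^sup>2 + (t a)\<^sup>2) / 2)"
    by (intro order_trans[OF sum_abs] sum_mono)
  also have "\<dots> = 1"
    using m t by (simp add: sum.distrib flip: sum_divide_distrib)
  finally show ?thesis .
qed

text \<open>Serves twice: with the channel eigenvalues it makes the binomial parameters
  probabilities, and with \<open>(1, 1, 1)\<close> it bounds the inner products of columns.\<close>

lemma rot_diag_entry_bound:
  assumes "\<bar>l1\<bar> \<le> 1" "\<bar>l2\<bar> \<le> 1" "\<bar>l3\<bar> \<le> 1"
  shows "\<bar>(transpose (rot p) ** Diag (l1, l2, l3) ** rot q) $ i $ j\<bar> \<le> 1"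
proof -
  define l :: "3 \<Rightarrow> real" where "l = (\<lambda>a. if a = 1 then l1 else if a = 2 then l2 else l3)"
  have "(transpose (rot p) ** Diag (l1, l2, l3) ** rot q) $ i $ j
      = (\<Sum>a\<in>UNIV. rot p $ a $ i * l a * rot q $ a $ j)"
    by (simp add: matrix_matrix_mult_def transpose_def sum_3 l_def del: rot.simps)
  then show ?thesis
    using unit_diag_bilinear_bound[OF rot_col_norm rot_col_norm, of l] assms
    by (simp add: l_def del: rot.simps)
qed

section \<open>Exact mean squared error\<close>

lemma channel_mse_formula:
  assumes lam: "admissible_eigvals (l1, l2, l3)" and N: "N \<ge> 1"
    and data: "tomography_data P D (data_mean (l1, l2, l3) (0, 0, 0) tau theta) N"
    and est: "eigen_rule est"
  defines "S \<equiv> transpose (rot tau) ** rot theta"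
    and "X \<equiv> data_mean (l1, l2, l3) (0, 0, 0) tau theta"
  shows "channel_mse est P D (l1, l2, l3) (0, 0, 0) tau theta N
    = (\<Sum>(i, j)\<in>UNIV. (1 - (X $ i $ j)\<^sup>2) / real N * ((1 + (S $ i $ j)\<^sup>2) / 2))"
proof -
  have X: "X = transpose (rot tau) ** Diag (l1, l2, l3) ** rot theta"
    by (simp add: X_def data_mean_def channel_zero del: rot.simps Diag.simps)
  interpret prob_space P
    using data by (simp add: tomography_data_def)
  \<comment> \<open>The error in entry (i, j) is a fixed function \<open>Y i j\<close> of the count,
    so independence and expectations carry over from the counts.\<close>
  define Y where "Y = (\<lambda>i j k. 2 / real N * real k - 1 - X $ i $ j)"
  define e where "e = (\<lambda>(i, j) w. Y i j (D i j w))"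
  have dist: "distr P (count_space UNIV) (D i j)
      = measure_pmf (binomial_pmf N ((1 + X $ i $ j) / 2))" for i j
    using data by (simp add: tomography_data_def X_def)
  have indepD: "indep_vars (\<lambda>_. count_space UNIV) (\<lambda>(i, j). D i j) UNIV"
    using data by (simp add: tomography_data_def)
  have meas: "D i j \<in> P \<rightarrow>\<^sub>M count_space UNIV" for i j
    using indepD by (auto simp: indep_vars_def dest: bspec[of _ _ "(i, j)"])
  have prob: "(1 + X $ i $ j) / 2 \<in> {0..1}" for i j
    using rot_diag_entry_bound[OF admissible_eigvals_bound[OF lam], of tau theta i j]
    by (simp add: X abs_le_iff del: rot.simps Diag.simps)
  have int: "integrable P (\<lambda>w. f (D i j w))" for i j and f :: "nat \<Rightarrow> real"
    by (subst integrable_distr_eq[OF meas, of f, symmetric])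
      (simp_all only: dist integrable_binomial_pmf[OF prob] borel_measurable_count_space)
  have expect: "expectation (\<lambda>w. f (D i j w))
      = measure_pmf.expectation (binomial_pmf N ((1 + X $ i $ j) / 2)) f"
    for i j and f :: "nat \<Rightarrow> real"
    by (subst integral_distr[OF meas, of f, symmetric]) (simp_all add: dist)
  have Yalt: "Y i j = (\<lambda>k. 2 / real N * (real k - real N * ((1 + X $ i $ j) / 2)))" for i j
    using N by (auto simp: Y_def field_simps)
  have centered: "expectation (e (i, j)) = 0" for i j
    unfolding e_def case_prod_conv expect[of "Y i j" i j]
    by (simp add: Yalt integrable_binomial_pmf[OF prob] binomial_pmf_first_moment[OF prob])
  have var: "expectation (\<lambda>w. (e (i, j) w)\<^sup>2) = (1 - (X $ i $ j)\<^sup>2) / real N" for i j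
  proof -
    have "expectation (\<lambda>w. (e (i, j) w)\<^sup>2) = (2 / real N)\<^sup>2 *
        measure_pmf.expectation (binomial_pmf N ((1 + X $ i $ j) / 2))
          (\<lambda>k. (real k - real N * ((1 + X $ i $ j) / 2))\<^sup>2)"
      unfolding e_def case_prod_conv expect[of "\<lambda>k. (Y i j k)\<^sup>2" i j]
      unfolding Yalt power_mult_distrib by (rule integral_mult_right_zero)
    \<comment> \<open>With p = (1 + x) / 2, the factor 4 p (1 - p) is (1 + x) (1 - x).\<close>
    also have "\<dots> = (1 - (X $ i $ j)\<^sup>2) / real N"
      unfolding binomial_pmf_centered_second_moment[OF prob]
      using N by (simp add: power2_eq_square field_simps)
    finally show ?thesis .
  qed
  have indep: "indep_vars (\<lambda>_. borel) e UNIV"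
  proof -
    have "indep_vars (\<lambda>_. borel) (\<lambda>p w. (case p of (i, j) \<Rightarrow> Y i j) ((case p of (i, j) \<Rightarrow> D i j) w)) UNIV"
      by (rule indep_vars_compose2[OF indepD]) auto
    then show ?thesis
      by (simp add: e_def case_prod_beta')
  qed
  \<comment> \<open>Rotating \<open>X\<close> back recovers the diagonal channel matrix, which
    symmetrisation fixes; only the rotated error \<open>E\<close> remains.\<close>
  have err: "A_hat_s tau theta N (\<lambda>i j. D i j w) - Diag (l1, l2, l3)
      = (\<Sum>p\<in>UNIV. e p w *\<^sub>R (case p of (i, j) \<Rightarrow> sym_dyad (rot tau) (rot theta) i j))" for w
  proof -
    define E where "E = X_hat N (\<lambda>i j. D i j w) - X"
    have E: "E $ i $ j = e (i, j) w" for i j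
      by (simp add: E_def X_hat_def e_def Y_def)
    have "rot tau ** X ** transpose (rot theta)
        = (rot tau ** transpose (rot tau)) ** Diag (l1, l2, l3) ** (rot theta ** transpose (rot theta))"
      by (simp only: X matrix_mul_assoc)
    then have RX: "rot tau ** X ** transpose (rot theta) = Diag (l1, l2, l3)"
      by (simp only: orthogonal_rot' matrix_mul_lid matrix_mul_rid)
    have "X_hat N (\<lambda>i j. D i j w) = E + X"
      by (simp add: E_def)
    then have A: "A_hat tau theta N (\<lambda>i j. D i j w)
        = rot tau ** E ** transpose (rot theta) + Diag (l1, l2, l3)"
      unfolding RX[symmetric]
      by (simp add: A_hat_def matrix_add_ldistrib matrix_add_rdistrib del: rot.simps)
    have symD: "transpose (Diag (l1, l2, l3)) = Diag (l1, l2, l3)"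
      by (simp add: matrix3_eq_iff transpose_def)
    have transpose_add: "transpose (B + C) = transpose B + transpose C" for B C :: "real^3^3"
      by (simp add: transpose_def vec_eq_iff)
    have "A_hat_s tau theta N (\<lambda>i j. D i j w) - Diag (l1, l2, l3)
        = (1/2) *\<^sub>R (rot tau ** E ** transpose (rot theta)
            + transpose (rot tau ** E ** transpose (rot theta)))"
      unfolding A_hat_s_def A transpose_add symD
      by (simp add: vec_eq_iff field_simps del: rot.simps Diag.simps)
    then show ?thesis
      unfolding sym_part_eq_sum_sym_dyad E by (simp add: case_prod_beta')
  qed
  have "channel_mse est P D (l1, l2, l3) (0, 0, 0) tau theta N
      = expectation (\<lambda>w. (norm (A_hat_s tau theta N (\<lambda>i j. D i j w) - Diag (l1, l2, l3)))\<^sup>2)"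
  proof -
    \<comment> \<open>\<open>eigen_rule\<close> speaks about symmetric matrices only; on these the
      estimated channel equals the matrix itself, whichever eigenbasis is chosen.\<close>
    have "transpose (A_hat_s tau theta N d) = A_hat_s tau theta N d" for d
      by (simp add: A_hat_s_def transpose_def vec_eq_iff add.commute)
    then show ?thesis
      using est unfolding channel_mse_def eigen_rule_def channel_zero
      by (simp add: Let_def case_prod_beta' del: Diag.simps)
  qed
  also have "\<dots> = (\<Sum>p\<in>UNIV. expectation (\<lambda>w. (e p w)\<^sup>2)
      * (norm (case p of (i, j) \<Rightarrow> sym_dyad (rot tau) (rot theta) i j))\<^sup>2)"
    unfolding err
    by (rule expectation_norm_sum_sq_indep[OF finite indep])
      (auto simp: centered, auto simp: e_def int int[of "\<lambda>k. (Y _ _ k)\<^sup>2"])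
  also have "\<dots> = (\<Sum>(i, j)\<in>UNIV. (1 - (X $ i $ j)\<^sup>2) / real N * ((1 + (S $ i $ j)\<^sup>2) / 2))"
    by (intro sum.cong refl)
      (auto simp: var norm_sym_dyad_sq[OF rot_col_norm rot_col_norm] S_def simp del: rot.simps)
  finally show ?thesis .
qed

section \<open>Lower bound and its attainment at zero angles\<close>

theorem theorem7:
  fixes l1 l2 l3 :: real and N :: nat and tau theta :: angles
    and P :: "'w measure" and D :: "3 \<Rightarrow> 3 \<Rightarrow> 'w \<Rightarrow> nat"
    and est :: "real^3^3 \<Rightarrow> eigvals \<times> angles"
  assumes "admissible_eigvals (l1, l2, l3)"
    and "N \<ge> 1"
    and "admissible_angles tau"
    and "admissible_angles theta"
    and "tomography_data P D (data_mean (l1, l2, l3) (0, 0, 0) tau theta) N"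
    and "eigen_rule est"
  shows "channel_mse est P D (l1, l2, l3) (0, 0, 0) tau theta N
           \<ge> 1 / real N * (6 - (l1\<^sup>2 + l2\<^sup>2 + l3\<^sup>2)) \<and>
         (tau = (0, 0, 0) \<and> theta = (0, 0, 0) \<longrightarrow>
           channel_mse est P D (l1, l2, l3) (0, 0, 0) tau theta N
             = 1 / real N * (6 - (l1\<^sup>2 + l2\<^sup>2 + l3\<^sup>2)))"
proof -
  define S where "S = transpose (rot tau) ** rot theta"
  define X where "X = transpose (rot tau) ** Diag (l1, l2, l3) ** rot theta"
  define L where "L = l1\<^sup>2 + l2\<^sup>2 + l3\<^sup>2"
  \<comment> \<open>The only contribution to the error that still depends on the angles.\<close>
  define R where "R = (\<Sum>i\<in>UNIV. \<Sum>j\<in>UNIV. (S $ i $ j)\<^sup>2 * (X $ i $ j)\<^sup>2)"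
  have mean: "data_mean (l1, l2, l3) (0, 0, 0) tau theta = X"
    by (simp add: X_def data_mean_def channel_zero del: rot.simps Diag.simps)
  \<comment> \<open>In this form \<open>S\<close> falls under the same norm identity and entry bound
    as \<open>X\<close>.\<close>
  have S': "S = transpose (rot tau) ** Diag (1, 1, 1) ** rot theta"
  proof -
    have "Diag (1, 1, 1) = mat 1"
      by (simp add: matrix3_eq_iff mat_def)
    then show ?thesis
      by (simp add: S_def del: rot.simps Diag.simps)
  qed
  have normDiag: "(norm (Diag (a, b, c)))\<^sup>2 = a\<^sup>2 + b\<^sup>2 + c\<^sup>2" for a b c
    by (simp add: norm_matrix_sq sum_3)
  have sumX: "(\<Sum>i\<in>UNIV. \<Sum>j\<in>UNIV. (X $ i $ j)\<^sup>2) = L"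
    unfolding norm_matrix_sq[symmetric] X_def norm_rot_conjugate normDiag L_def ..
  have sumS: "(\<Sum>i\<in>UNIV. \<Sum>j\<in>UNIV. (S $ i $ j)\<^sup>2) = 3"
    unfolding norm_matrix_sq[symmetric] S' norm_rot_conjugate normDiag by simp
  have "channel_mse est P D (l1, l2, l3) (0, 0, 0) tau theta N
      = (\<Sum>i\<in>UNIV. \<Sum>j\<in>UNIV. (1 - (X $ i $ j)\<^sup>2) / real N * ((1 + (S $ i $ j)\<^sup>2) / 2))"
    unfolding channel_mse_formula[OF assms(1,2,5,6)] mean S_def[symmetric]
    by (simp add: sum.cartesian_product)
  \<comment> \<open>Expand (1 - x^2) (1 + s^2) over the nine index pairs.\<close>
  also have "\<dots> = (9 - (\<Sum>i\<in>UNIV. \<Sum>j\<in>UNIV. (X $ i $ j)\<^sup>2)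
      + (\<Sum>i\<in>UNIV. \<Sum>j\<in>UNIV. (S $ i $ j)\<^sup>2) - R) / (2 * real N)"
    using assms(2) by (simp add: R_def sum_3 field_simps)
  also have "\<dots> = (12 - L - R) / (2 * real N)"
    by (simp add: sumX sumS)
  finally have mse: "channel_mse est P D (l1, l2, l3) (0, 0, 0) tau theta N
      = (12 - L - R) / (2 * real N)" .
  have "R \<le> (\<Sum>i\<in>UNIV. \<Sum>j\<in>UNIV. (X $ i $ j)\<^sup>2)"
    unfolding R_def
  proof (intro sum_mono)
    fix i j
    have "(S $ i $ j)\<^sup>2 \<le> 1"
      unfolding abs_square_le_1 S' by (rule rot_diag_entry_bound) simp_all
    then show "(S $ i $ j)\<^sup>2 * (X $ i $ j)\<^sup>2 \<le> (X $ i $ j)\<^sup>2"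
      by (simp add: mult_left_le_one_le)
  qed
  then have "R \<le> L"
    by (simp add: sumX)
  then have "channel_mse est P D (l1, l2, l3) (0, 0, 0) tau theta N \<ge> 1 / real N * (6 - L)"
    using assms(2) by (simp add: mse field_simps)
  moreover have "channel_mse est P D (l1, l2, l3) (0, 0, 0) tau theta N = 1 / real N * (6 - L)"
    if "tau = (0, 0, 0)" "theta = (0, 0, 0)"
  proof -
    \<comment> \<open>Here \<open>S\<close> is the identity and \<open>X\<close> is diagonal, so
      each squared eigenvalue enters with weight 1.\<close>
    have "R = L"
      using that by (simp add: R_def S_def X_def L_def matrix3_simps)
    then show ?thesis
      using assms(2) by (simp add: mse field_simps)
  qed
  ultimately show ?thesis
    unfolding L_def by blast
qed

end
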